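(* Let $(X,\rho)$ be a metric space with $|X|\geq 3$, let $\lambda\in[0,1)$, and let $T:X\to CB(X)$ be a multivalued $\lambda$-contracting perimeters of triangles mapping on $X$, i.e. $$H(Tx,Ty)+H(Ty,Tz)+H(Tx,Tz)\leq \lambda\left(\rho(x,y)+\rho(y,z)+\rho(x,z)\right)$$ for all three pairwise distinct points $x,y,z\in X$. Then $T$ is continuous as a map from $(X,\rho)$ to $(CB(X),H)$.
   Context: For a metric space $(X,\rho)$, $CB(X)$ denotes the class of all nonempty closed and bounded subsets of $X$, and $H$ is the Pompeiu–Hausdorff metric on $CB(X)$ induced by $\rho$: $H(A,B)=\max\{\sup_{a\in A}\rho(a,B),\ \sup_{b\in B}\rho(b,A)\}$, where $\rho(a,B)=\inf_{b\in B}\rho(a,b)$. Continuity of $T$ at $x_0$ means that $x_n\to x_0$ implies $H(Tx_0,Tx_n)\to 0$. *)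

theory Defs
  imports "HOL-Analysis.Analysis"
begin

definition CB :: "'a::metric_space set set" where
  "CB = {A. A \<noteq> {} \<and> closed A \<and> bounded A}"

text \<open>Intended for arguments in \<open>CB\<close>: there the real-valued suprema are taken over nonempty
  sets that are bounded above, and \<open>infdist\<close> is the infimum of the distances (its special
  value for the empty set plays no role).\<close>

definition hausdorff_dist :: "'a::metric_space set \<Rightarrow> 'a set \<Rightarrow> real" where
  "hausdorff_dist A B = max (SUP a\<in>A. infdist a B) (SUP b\<in>B. infdist b A)"

definition contracting_perimeters :: "real \<Rightarrow> ('a::metric_space \<Rightarrow> 'a set) \<Rightarrow> bool" where
  "contracting_perimeters c T \<longleftrightarrow>
     (\<forall>x y z. x \<noteq> y \<and> y \<noteq> z \<and> x \<noteq> z \<longrightarrow>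
        hausdorff_dist (T x) (T y) + hausdorff_dist (T y) (T z) + hausdorff_dist (T x) (T z)
          \<le> c * (dist x y + dist y z + dist x z))"

definition hausdorff_continuous_at :: "('a::metric_space \<Rightarrow> 'a set) \<Rightarrow> 'a \<Rightarrow> bool" where
  "hausdorff_continuous_at T x0 \<longleftrightarrow>
     (\<forall>x :: nat \<Rightarrow> 'a. x \<longlonglongrightarrow> x0 \<longrightarrow> (\<lambda>n. hausdorff_dist (T x0) (T (x n))) \<longlonglongrightarrow> 0)"

end

(* At a non-isolated point x0, any x \<noteq> x0 admits a third point y at least as close to x0 as x is,
   so the perimeter of x0, x, y is at most 4 d(x0, x), and H(T x0, T x) is at most 4 c d(x0, x).
   At an isolated point, convergent sequences are eventually constant. *)
theory Submission
  imports Defs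
begin

text \<open>Both suprema run over the constant 0; \<open>A\<close> must be nonempty because
  \<open>Sup {}\<close> has no prescribed value on the reals.\<close>

lemma hausdorff_dist_self: "A \<noteq> {} \<Longrightarrow> hausdorff_dist A A = 0"
  by (simp add: hausdorff_dist_def)

text \<open>One entry of the maximum is enough: boundedness of \<open>A\<close> makes the first
  supremum a genuine upper bound, hence at least some \<open>infdist a B\<close>.\<close>

lemma hausdorff_dist_nonneg:
  assumes "A \<noteq> {}" "bounded A" "B \<noteq> {}"
  shows "0 \<le> hausdorff_dist A B"
proof -
  obtain a b where a: "a \<in> A" and b: "b \<in> B"
    using assms by blast
  \<comment> \<open>Centring the bound at a point \<open>b\<close> of \<open>B\<close> lets
    \<open>e\<close> bound \<open>infdist x B\<close> as well.\<close>
  obtain e where e: "\<And>x. x \<in> A \<Longrightarrow> dist b x \<le> e"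
    using \<open>bounded A\<close> bounded_any_center[of A b] by blast
  have "infdist x B \<le> e" if "x \<in> A" for x
    using infdist_le[OF b, of x] e[OF that] by (simp add: dist_commute)
  then have "bdd_above ((\<lambda>x. infdist x B) ` A)"
    by (rule bdd_aboveI2)
  then have "infdist a B \<le> (SUP x\<in>A. infdist x B)"
    using a by (rule cSUP_upper[rotated])
  then show ?thesis
    using infdist_nonneg[of a B] by (simp add: hausdorff_dist_def)
qed

lemma hausdorff_dist_le_at_limit_point:
  fixes T :: "'a::metric_space \<Rightarrow> 'a set"
  assumes "0 \<le> c" and CB: "\<And>x. T x \<in> CB" and contr: "contracting_perimeters c T"
    and lim: "x0 islimpt UNIV"
  shows "hausdorff_dist (T x0) (T x) \<le> 4 * c * dist x x0"
proof (cases "x = x0")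
  case True
  then show ?thesis
    using CB[of x0] by (simp add: hausdorff_dist_self CB_def)
next
  case False
  then have "0 < dist x x0"
    by simp
  then obtain y where y: "y \<noteq> x0" "dist y x0 < dist x x0"
    using lim unfolding islimpt_approachable by blast
  \<comment> \<open>The strict inequality separates \<open>y\<close> from \<open>x\<close>, so the
    three points are pairwise distinct, as the contraction condition demands.\<close>
  then have "y \<noteq> x"
    by blast
  have nonneg: "0 \<le> hausdorff_dist (T u) (T v)" for u v
    using CB[of u] CB[of v] by (simp add: CB_def hausdorff_dist_nonneg)
  have "hausdorff_dist (T x0) (T x)
      \<le> hausdorff_dist (T x0) (T x) + hausdorff_dist (T x) (T y) + hausdorff_dist (T x0) (T y)"
    using nonneg[of x y] nonneg[of x0 y] by simp
  also have "\<dots> \<le> c * (dist x0 x + dist x y + dist x0 y)"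
    using contr[unfolded contracting_perimeters_def, rule_format, of x0 x y] False y \<open>y \<noteq> x\<close>
    by simp
  \<comment> \<open>The factor 4 is 1 + 2 + 1: the sides at \<open>x0\<close> are at most
    \<open>dist x x0\<close>, and the side from \<open>x\<close> to \<open>y\<close> is at most the
    sum of those two.\<close>
  also have "\<dots> \<le> c * (4 * dist x x0)"
    using y dist_triangle2[of x y x0] \<open>0 \<le> c\<close>
    by (intro mult_left_mono) (auto simp: dist_commute)
  finally show ?thesis
    by simp
qed

theorem proposition1:
  fixes T :: "'a::metric_space \<Rightarrow> 'a set" and c :: real
  assumes "infinite (UNIV :: 'a set) \<or> card (UNIV :: 'a set) \<ge> 3"
    and "0 \<le> c" and "c < 1"
    and "\<And>x. T x \<in> CB"
    and "contracting_perimeters c T"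
  shows "\<forall>x0. hausdorff_continuous_at T x0"
  unfolding hausdorff_continuous_at_def
proof (intro allI impI)
  fix x0 :: 'a and x :: "nat \<Rightarrow> 'a"
  assume x: "x \<longlonglongrightarrow> x0"
  have CB: "T u \<noteq> {}" "bounded (T u)" for u
    using assms(4)[of u] by (auto simp: CB_def)
  show "(\<lambda>n. hausdorff_dist (T x0) (T (x n))) \<longlonglongrightarrow> 0"
  \<comment> \<open>Triangles with a vertex at an isolated point have perimeter bounded away from 0,
    so the linear estimate is used only at limit points.\<close>
  proof (cases "x0 islimpt UNIV")
    case True
    have "(\<lambda>n. 4 * c * dist (x n) x0) \<longlonglongrightarrow> 4 * c * 0"
      using tendsto_dist_iff[THEN iffD1, OF x] by (rule tendsto_mult_left)
    then have bound: "(\<lambda>n. 4 * c * dist (x n) x0) \<longlonglongrightarrow> 0"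
      by simp
    show ?thesis
    proof (rule tendsto_sandwich[OF always_eventually always_eventually tendsto_const bound])
      show "\<forall>n. 0 \<le> hausdorff_dist (T x0) (T (x n))"
        by (intro allI hausdorff_dist_nonneg CB)
      show "\<forall>n. hausdorff_dist (T x0) (T (x n)) \<le> 4 * c * dist (x n) x0"
        using hausdorff_dist_le_at_limit_point[OF assms(2,4,5) True] by (rule allI)
    qed
  next
    case False
    then have "open {x0}"
      by (simp add: islimpt_UNIV_iff)
    then have "eventually (\<lambda>n. x n = x0) sequentially"
      using topological_tendstoD[OF x, of "{x0}"] by simp
    then have "eventually (\<lambda>n. hausdorff_dist (T x0) (T (x n)) = 0) sequentially"
      by eventually_elim (simp add: CB hausdorff_dist_self)
    then show ?thesis
      by (rule tendsto_eventually)
  qed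
qed

end
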